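(* Let $G$ be a finite connected simple graph with vertex set $V(G)=\{1,\dots,n\}$ and $\mathrm{diam}(G)\ge 3$. Let $\mathrm{k}$ be a field, $S=\mathrm{k}[x_1,\dots,x_n]$, $\mathfrak m=(x_1,\dots,x_n)$, and let $NI(G)\subseteq S$ be the closed neighborhood ideal of $G$. Let $H$ be the hypergraph with vertex set $V(H)=V(G)$ whose edges are the sets $N_G[i]\cup N_G[j]$ for all pairs $i,j\in V(G)$ with $\mathrm{dist}_G(i,j)\ge 3$. Then $\mathfrak m$ is an associated prime of $S/NI(G)^2$ if and only if there exists a subset $C\subseteq V(G)$ such that: (1) $C$ is a vertex cover of $H$; (2) for every $i\in C$, there exists an edge $e\in E(H)$ such that $C\cap e=\{i\}$; (3) for every $j\in V(G)\setminus C$, there exist vertices $j_1,j_2\in N_G(j)$ such that $N_G[j_1]\subseteq V(G)\setminus C$, $N_G[j_2]\subseteq V(G)\setminus C$, $\mathrm{dist}_G(j_1,j_2)=2$, and $\mathrm{dist}_{G-j}(j_1,j_2)\ge 3$.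
   Context: For a vertex $i$ of $G$, $N_G(i)=\{j : \{i,j\}\in E(G)\}$ and $N_G[i]=N_G(i)\cup\{i\}$. For $W\subseteq\{1,\dots,n\}$, $x_W=\prod_{j\in W}x_j$. The closed neighborhood ideal of $G$ is $NI(G)=(x_{N_G[i]} \mid i=1,\dots,n)\subseteq S$. The distance $\mathrm{dist}_G(u,v)$ is the length of a shortest path in $G$ from $u$ to $v$, and is $\infty$ if there is no such path; $\mathrm{diam}(G)$ is the maximum distance between two vertices of $G$. For a vertex $j$, $G-j$ is the graph obtained from $G$ by removing $j$ and all edges incident to $j$. A vertex cover of a hypergraph $H$ is a subset $C\subseteq V(H)$ with $C\cap e\neq\emptyset$ for every edge $e\in E(H)$. A prime ideal $P$ of a Noetherian ring $R$ is an associated prime of an $R$-module $M$ if $P=\mathrm{Ann}(y)$ for some $y\in M$. *)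

theory Defs
  imports
    Graph_Theory.Graph_Theory
    "HOL-Library.Poly_Mapping"
    "HOL-Algebra.Ideal_Product"
    "HOL-Algebra.QuotRing"
    "HOL-Algebra.Module"
begin

section \<open>Graphs\<close>

text \<open>A finite simple graph is a \<^term>\<open>graph\<close> in the sense of \<open>Graph_Theory\<close>: a finite symmetric
  digraph without loops and without parallel arcs, an edge \<open>{i,j}\<close> being the pair of arcs
  \<open>i \<rightarrow> j\<close>, \<open>j \<rightarrow> i\<close>.\<close>

definition nbhd :: "('v, 'e) pre_digraph \<Rightarrow> 'v \<Rightarrow> 'v set" where
  "nbhd G i = {j. (i, j) \<in> arcs_ends G}"

definition closed_nbhd :: "('v, 'e) pre_digraph \<Rightarrow> 'v \<Rightarrow> 'v set" where
  "closed_nbhd G i = nbhd G i \<union> {i}"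

text \<open>\<open>wf_digraph.\<mu>\<close> is the infimum of the costs of the walks from \<open>u\<close> to \<open>v\<close> (\<open>\<infinity>\<close> if there are
  none); with unit weights the cost of a walk is its length.\<close>

definition gdist :: "('v, 'e) pre_digraph \<Rightarrow> 'v \<Rightarrow> 'v \<Rightarrow> ereal" where
  "gdist G u v = wf_digraph.\<mu> G (\<lambda>_. 1) u v"

definition diam :: "('v, 'e) pre_digraph \<Rightarrow> ereal" where
  "diam G = (SUP u\<in>verts G. SUP v\<in>verts G. gdist G u v)"


section \<open>Hypergraphs\<close>

type_synonym 'v hypergraph = "'v set \<times> 'v set set"

abbreviation hverts :: "'v hypergraph \<Rightarrow> 'v set" where
  "hverts H \<equiv> fst H"

abbreviation hedges :: "'v hypergraph \<Rightarrow> 'v set set" where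
  "hedges H \<equiv> snd H"

definition vertex_cover :: "'v hypergraph \<Rightarrow> 'v set \<Rightarrow> bool" where
  "vertex_cover H C \<longleftrightarrow> C \<subseteq> hverts H \<and> (\<forall>e\<in>hedges H. C \<inter> e \<noteq> {})"

definition nbhd_hypergraph :: "('v, 'e) pre_digraph \<Rightarrow> 'v hypergraph" where
  "nbhd_hypergraph G =
    (verts G,
     {closed_nbhd G i \<union> closed_nbhd G j | i j. i \<in> verts G \<and> j \<in> verts G \<and> gdist G i j \<ge> 3})"


section \<open>Associated primes\<close>

definition annihilator ::
    "('a, 'c) ring_scheme \<Rightarrow> ('a, 'b, 'd) module_scheme \<Rightarrow> 'b \<Rightarrow> 'a set" where
  "annihilator R M y = {r \<in> carrier R. r \<odot>\<^bsub>M\<^esub> y = \<zero>\<^bsub>M\<^esub>}"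

definition associated_prime ::
    "('a, 'c) ring_scheme \<Rightarrow> ('a, 'b, 'd) module_scheme \<Rightarrow> 'a set \<Rightarrow> bool" where
  "associated_prime R M P \<longleftrightarrow> primeideal P R \<and> (\<exists>y\<in>carrier M. P = annihilator R M y)"

text \<open>The quotient \<open>R/I\<close> as an \<open>R\<close>-module; a scalar \<open>r\<close> acts as multiplication by its residue
  class.\<close>

definition quot_module :: "('a, 'c) ring_scheme \<Rightarrow> 'a set \<Rightarrow> ('a, 'a set) module" where
  "quot_module R I =
    \<lparr>carrier = carrier (R Quot I), mult = mult (R Quot I), one = one (R Quot I),
     zero = zero (R Quot I), add = add (R Quot I),
     smult = (\<lambda>r X. (I +>\<^bsub>R\<^esub> r) \<otimes>\<^bsub>R Quot I\<^esub> X)\<rparr>"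

lemma quot_module_is_module:
  assumes "cring R" and "ideal I R"
  shows "module R (quot_module R I)"
proof -
  interpret R: cring R by fact
  interpret I: ideal I R by fact
  interpret Q: cring "R Quot I"
    by (rule I.quotient_is_cring[OF \<open>cring R\<close>])
  have hom: "(+>\<^bsub>R\<^esub>) I \<in> ring_hom R (R Quot I)"
    by (rule I.rcos_ring_hom)
  have cl: "I +>\<^bsub>R\<^esub> r \<in> carrier (R Quot I)" if "r \<in> carrier R" for r
    using ring_hom_closed[OF hom that] .
  have "abelian_group (quot_module R I)"
  proof (rule abelian_groupI, goal_cases)
    case (6 x)
    then show ?case
      by (intro bexI[of _ "\<ominus>\<^bsub>R Quot I\<^esub> x"]) (simp_all add: quot_module_def Q.l_neg)
  qed (simp_all add: quot_module_def Q.a_ac)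
  then show ?thesis
    by (intro module.intro module_axioms.intro \<open>cring R\<close>)
      (simp_all add: quot_module_def cl ring_hom_add[OF hom] ring_hom_mult[OF hom]
        ring_hom_one[OF hom] Q.l_distr Q.r_distr Q.m_assoc)
qed


section \<open>Polynomial rings and closed neighborhood ideals\<close>

text \<open>Monomials are finitely supported exponent vectors; \<open>poly_ring V\<close> is the ring of polynomials
  in the variables indexed by \<open>V\<close>.\<close>

type_synonym ('v, 'k) mpoly = "('v \<Rightarrow>\<^sub>0 nat) \<Rightarrow>\<^sub>0 'k"

definition poly_ring :: "'v set \<Rightarrow> ('v, 'k::comm_ring_1) mpoly ring" where
  "poly_ring V =
    \<lparr>carrier = {p. \<forall>m\<in>Poly_Mapping.keys p. Poly_Mapping.keys m \<subseteq> V},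
     mult = (*), one = 1, zero = 0, add = (+)\<rparr>"

definition mvar :: "'v \<Rightarrow> ('v, 'k::comm_ring_1) mpoly" where
  "mvar i = Poly_Mapping.single (Poly_Mapping.single i 1) 1"

definition squarefree_monom :: "'v set \<Rightarrow> ('v, 'k::comm_ring_1) mpoly" where
  "squarefree_monom W = (\<Prod>j\<in>W. mvar j)"

definition irrelevant_ideal :: "'v set \<Rightarrow> ('v, 'k::comm_ring_1) mpoly set" where
  "irrelevant_ideal V = Idl\<^bsub>poly_ring V\<^esub> (mvar ` V)"

definition nbhd_ideal :: "('v, 'e) pre_digraph \<Rightarrow> ('v, 'k::comm_ring_1) mpoly set" where
  "nbhd_ideal G =
    Idl\<^bsub>poly_ring (verts G)\<^esub> ((\<lambda>i. squarefree_monom (closed_nbhd G i)) ` verts G)"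

lemma poly_ring_cring: "cring (poly_ring V :: ('v, 'k::comm_ring_1) mpoly ring)"
proof -
  let ?S = "{p :: ('v, 'k) mpoly. \<forall>m\<in>Poly_Mapping.keys p. Poly_Mapping.keys m \<subseteq> V}"
  have add: "p + q \<in> ?S" if "p \<in> ?S" "q \<in> ?S" for p q
    using that Poly_Mapping.keys_add[of p q] by fastforce
  have mult: "p * q \<in> ?S" if pq: "p \<in> ?S" "q \<in> ?S" for p q
  proof -
    have "Poly_Mapping.keys m \<subseteq> V" if m: "m \<in> Poly_Mapping.keys (p * q)" for m
    proof -
      from m keys_mult[of p q] have
        "m \<in> {a + b | a b. a \<in> Poly_Mapping.keys p \<and> b \<in> Poly_Mapping.keys q}"
        by (rule rev_subsetD)
      then obtain a b where "m = a + b" "a \<in> Poly_Mapping.keys p" "b \<in> Poly_Mapping.keys q"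
        by auto
      moreover from this pq have "Poly_Mapping.keys a \<subseteq> V" "Poly_Mapping.keys b \<subseteq> V"
        by auto
      ultimately show ?thesis
        using Poly_Mapping.keys_add[of a b] by auto
    qed
    then show ?thesis by simp
  qed
  have neg: "- p \<in> ?S" if "p \<in> ?S" for p
    using that by simp
  have "abelian_group (poly_ring V :: ('v, 'k) mpoly ring)"
  proof (rule abelian_groupI, goal_cases)
    case (1 x y)
    then show ?case using add[of x y] by (simp add: poly_ring_def)
  next
    case (6 x)
    then show ?case
      using neg[of x] by (intro bexI[of _ "- x"]) (simp_all add: poly_ring_def)
  qed (simp_all add: poly_ring_def ac_simps)
  moreover have "comm_monoid (poly_ring V :: ('v, 'k) mpoly ring)"
  proof (rule comm_monoidI, goal_cases)
    case (1 x y)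
    then show ?case using mult[of x y] by (simp add: poly_ring_def)
  qed (simp_all add: poly_ring_def ac_simps)
  ultimately show ?thesis
    by (intro cringI) (simp_all add: poly_ring_def distrib_right)
qed

end

theory Submission
  imports Defs
begin

text \<open>An exponent vector \<open>u\<close> is called a socle exponent of a monomial ideal \<open>I\<close> if
  \<open>x\<^sup>u \<notin> I\<close> but \<open>x\<^sub>k x\<^sup>u \<in> I\<close> for every variable \<open>x\<^sub>k\<close>. The irrelevant ideal is an associated prime
  of \<open>S/I\<close> exactly when such a \<open>u\<close> exists (\<open>associated_prime_irrelevant_ideal_iff\<close>): if it is
  the annihilator of the class of \<open>y\<close>, then any term of \<open>y\<close> outside \<open>I\<close> gives a \<open>u\<close>, because
  membership in \<open>I\<close> is decided term by term.

  Let \<open>I\<close> be generated by squarefree monomials with supports \<open>N i\<close>, so that \<open>I\<^sup>2\<close> is generated by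
  the monomials with exponents \<open>1\<^bsub>N i\<^esub> + 1\<^bsub>N j\<^esub>\<close>. If \<open>u\<close> is a socle exponent of \<open>I\<^sup>2\<close>, then for each
  \<open>k\<close> some generator divides \<open>x\<^sub>k x\<^sup>u\<close> but not \<open>x\<^sup>u\<close>, hence has exponent exactly \<open>u k + 1\<close> at \<open>k\<close>.
  That exponent is at most 2, so \<open>u\<close> takes only the values 0 and 1 and is determined by its zero set
  \<open>C\<close>. Written in terms of \<open>C\<close>, \<open>x\<^sup>u \<notin> I\<^sup>2\<close> says that \<open>C\<close> meets \<open>N i \<union> N j\<close> for
  all disjoint \<open>N i\<close>, \<open>N j\<close>; the condition at \<open>k \<in> C\<close> says that some such union meets \<open>C\<close> in \<open>k\<close>
  only; and the condition at \<open>k \<notin> C\<close> says that \<open>N i \<inter> N j = {k}\<close> for some \<open>N i\<close>, \<open>N j\<close> that avoid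
  \<open>C\<close> (\<open>socle_exponent_iff_cover\<close>).

  For closed neighborhoods this becomes a statement about distances. Two closed neighborhoods are
  disjoint iff the distance of their centers is at least 3. If no vertex is isolated, they meet
  exactly in \<open>k\<close> iff the centers are neighbors of \<open>k\<close> at distance 2 whose closed neighborhoods
  become disjoint, hence whose distance becomes at least 3, once \<open>k\<close> is removed
  (\<open>closed_nbhd_Int_eq_singleton_iff\<close>). Connectedness and the bound on the diameter exclude isolated
  vertices.\<close>


section \<open>Monomial ideals\<close>

text \<open>The description by divisibility of terms is taken as the definition, since it makes
  membership a condition on each term separately; \<open>genideal_monoms\<close> identifies this set with the
  ideal generated by the monomials with exponents in \<open>A\<close>.\<close>

definition monomial_ideal ::
    "'v set \<Rightarrow> ('v \<Rightarrow>\<^sub>0 nat) set \<Rightarrow> ('v, 'k::comm_ring_1) mpoly set" where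
  "monomial_ideal V A =
    {p \<in> carrier (poly_ring V). \<forall>m\<in>Poly_Mapping.keys p. \<exists>a\<in>A. \<exists>c. m = a + c}"

abbreviation monom :: "('v \<Rightarrow>\<^sub>0 nat) \<Rightarrow> ('v, 'k::comm_ring_1) mpoly" where
  "monom m \<equiv> Poly_Mapping.single m 1"

lemma monomial_ideal_carrier: "p \<in> monomial_ideal V A \<Longrightarrow> p \<in> carrier (poly_ring V)"
  by (simp add: monomial_ideal_def)

lemma monomial_idealE:
  assumes "p \<in> monomial_ideal V A" and "m \<in> Poly_Mapping.keys p"
  obtains a c where "a \<in> A" and "m = a + c"
  using assms unfolding monomial_ideal_def by blast

lemma poly_ring_sel [simp]:
  "x \<otimes>\<^bsub>poly_ring V\<^esub> y = x * y" "\<one>\<^bsub>poly_ring V\<^esub> = 1" "\<zero>\<^bsub>poly_ring V\<^esub> = 0"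
  "x \<oplus>\<^bsub>poly_ring V\<^esub> y = x + y"
  by (simp_all add: poly_ring_def)

lemma mem_poly_ring:
  "p \<in> carrier (poly_ring V) \<longleftrightarrow> (\<forall>m\<in>Poly_Mapping.keys p. Poly_Mapping.keys m \<subseteq> V)"
  by (simp add: poly_ring_def)

lemma keys_multE:
  assumes "m \<in> Poly_Mapping.keys (p * q)"
  obtains s t where "s \<in> Poly_Mapping.keys p" and "t \<in> Poly_Mapping.keys q" and "m = s + t"
  using subsetD[OF keys_mult assms] by blast

lemma keys_add_nat:
  "Poly_Mapping.keys (a + b) = Poly_Mapping.keys a \<union> Poly_Mapping.keys (b :: 'v \<Rightarrow>\<^sub>0 nat)"
  by (auto simp: in_keys_iff lookup_add)

lemma sum_single_lookup:
  "(\<Sum>m\<in>Poly_Mapping.keys p. Poly_Mapping.single m (Poly_Mapping.lookup p m)) = p"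
  by (rule poly_mapping_eqI)
    (auto simp: lookup_sum lookup_single when_def not_in_keys_iff_lookup_eq_zero)

text \<open>Multiplication by a monomial translates the exponents, so no terms can cancel.\<close>

lemma lookup_monom_mult:
  fixes p :: "('v, 'k::comm_ring_1) mpoly"
  shows "Poly_Mapping.lookup (monom u * p) (u + v) = Poly_Mapping.lookup p v"
proof -
  have "monom u * p =
      (\<Sum>m\<in>Poly_Mapping.keys p. Poly_Mapping.single (u + m) (Poly_Mapping.lookup p m))"
    by (subst sum_single_lookup[of p, symmetric]) (simp add: sum_distrib_left mult_single)
  then show ?thesis
    by (auto simp: lookup_sum lookup_single when_def not_in_keys_iff_lookup_eq_zero)
qed

lemma ideal_monomial_ideal:
  "ideal (monomial_ideal V A :: ('v, 'k::comm_ring_1) mpoly set) (poly_ring V)"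
proof -
  let ?R = "poly_ring V :: ('v, 'k) mpoly ring"
  let ?I = "monomial_ideal V A :: ('v, 'k) mpoly set"
  interpret R: cring ?R by (rule poly_ring_cring)
  have mult: "x * a \<in> ?I" if a: "a \<in> ?I" and x: "x \<in> carrier ?R" for a x
  proof -
    have "x * a \<in> carrier ?R"
      using R.m_closed[of x a] that by (simp add: monomial_ideal_def)
    moreover have "\<exists>b\<in>A. \<exists>c. m = b + c" if m: "m \<in> Poly_Mapping.keys (x * a)" for m
    proof -
      obtain s t where t: "t \<in> Poly_Mapping.keys a" and "m = s + t"
        using keys_multE[OF m] .
      moreover obtain b c where "b \<in> A" "t = b + c"
        using monomial_idealE[OF a t] .
      ultimately have "m = b + (s + c)" by (simp add: ac_simps)
      with \<open>b \<in> A\<close> show ?thesis by blast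
    qed
    ultimately show ?thesis by (simp add: monomial_ideal_def)
  qed
  have add: "a + b \<in> ?I" if "a \<in> ?I" "b \<in> ?I" for a b
    using that R.a_closed[of a b] Poly_Mapping.keys_add[of a b]
    by (auto simp: monomial_ideal_def)
  have neg: "\<ominus>\<^bsub>?R\<^esub> a \<in> ?I" if a: "a \<in> ?I" for a
  proof -
    have "a \<in> carrier ?R" using a by (simp add: monomial_ideal_def)
    then have "\<ominus>\<^bsub>?R\<^esub> a = (\<ominus>\<^bsub>?R\<^esub> \<one>\<^bsub>?R\<^esub>) * a"
      using R.l_minus[OF R.one_closed, of a] R.l_one[of a] by (simp del: R.l_one)
    then show ?thesis using mult[OF a, of "\<ominus>\<^bsub>?R\<^esub> \<one>\<^bsub>?R\<^esub>"]
      by (simp only: R.a_inv_closed R.one_closed)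
  qed
  show ?thesis
  proof (rule idealI)
    show "subgroup ?I (add_monoid ?R)"
    proof (rule R.add.subgroupI)
      show "?I \<subseteq> carrier ?R"
        using monomial_ideal_carrier by (rule subsetI)
      have "0 \<in> ?I"
        using R.zero_closed by (simp add: monomial_ideal_def)
      then show "?I \<noteq> {}" by blast
      show "\<ominus>\<^bsub>?R\<^esub> a \<in> ?I" if "a \<in> ?I" for a
        using neg[OF that] .
      show "a \<oplus>\<^bsub>?R\<^esub> b \<in> ?I" if "a \<in> ?I" "b \<in> ?I" for a b
        using add[OF that] by simp
    qed
  qed (use mult R.ring_axioms in \<open>simp_all only: poly_ring_sel mult.commute\<close>)
qed

text \<open>A polynomial is the sum of its terms, and an ideal is closed under finite sums.\<close>

lemma mem_ideal_if_terms_mem: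
  fixes p :: "('v, 'k::comm_ring_1) mpoly"
  assumes "ideal J (poly_ring V)"
    and "\<And>m. m \<in> Poly_Mapping.keys p \<Longrightarrow> Poly_Mapping.single m (Poly_Mapping.lookup p m) \<in> J"
  shows "p \<in> J"
proof -
  interpret J: ideal J "poly_ring V" by fact
  have "(\<Sum>m\<in>M. Poly_Mapping.single m (Poly_Mapping.lookup p m)) \<in> J"
    if "M \<subseteq> Poly_Mapping.keys p" "finite M" for M
    using that(2,1)
  proof (induction M rule: finite_induct)
    case empty
    then show ?case using additive_subgroup.zero_closed[OF J.additive_subgroup_axioms] by simp
  next
    case (insert m M)
    then show ?case using additive_subgroup.a_closed[OF J.additive_subgroup_axioms] assms(2)[of m] by simp
  qed
  from this[of "Poly_Mapping.keys p"] show ?thesis by (simp add: sum_single_lookup)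
qed

lemma monomial_ideal_subset:
  fixes J :: "('v, 'k::comm_ring_1) mpoly set"
  assumes J: "ideal J (poly_ring V)" and A: "monom ` A \<subseteq> J"
  shows "monomial_ideal V A \<subseteq> J"
proof
  interpret J: ideal J "poly_ring V" by fact
  fix p :: "('v, 'k) mpoly"
  assume p: "p \<in> monomial_ideal V A"
  show "p \<in> J"
  proof (rule mem_ideal_if_terms_mem[OF J])
    fix m assume m: "m \<in> Poly_Mapping.keys p"
    then obtain a c where a: "a \<in> A" "m = a + c"
      using p by (auto simp: monomial_ideal_def)
    have "Poly_Mapping.keys m \<subseteq> V"
      using p m by (auto simp: monomial_ideal_def mem_poly_ring)
    then have "Poly_Mapping.single c (Poly_Mapping.lookup p m) \<in> carrier (poly_ring V)"
      using a by (auto simp: mem_poly_ring keys_add_nat)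
    then have "Poly_Mapping.single c (Poly_Mapping.lookup p m) * monom a \<in> J"
      using J.I_l_closed[of "monom a"] A a by auto
    then show "Poly_Mapping.single m (Poly_Mapping.lookup p m) \<in> J"
      using a by (simp add: mult_single add.commute)
  qed
qed

lemma monom_mem_monomial_ideal:
  assumes "a \<in> A" and "Poly_Mapping.keys (a + c) \<subseteq> V"
  shows "monom (a + c) \<in> monomial_ideal V A"
  using assms by (auto simp: monomial_ideal_def mem_poly_ring)

lemma genideal_monoms:
  fixes A :: "('v \<Rightarrow>\<^sub>0 nat) set"
  assumes "\<And>a. a \<in> A \<Longrightarrow> Poly_Mapping.keys a \<subseteq> V"
  shows "Idl\<^bsub>poly_ring V\<^esub> (monom ` A :: ('v, 'k::comm_ring_1) mpoly set) = monomial_ideal V A"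
proof
  let ?R = "poly_ring V :: ('v, 'k) mpoly ring"
  interpret R: cring ?R by (rule poly_ring_cring)
  have gen: "monom ` A \<subseteq> (monomial_ideal V A :: ('v, 'k) mpoly set)"
    using monom_mem_monomial_ideal[of _ A 0 V] assms by auto
  then show "Idl\<^bsub>?R\<^esub> (monom ` A) \<subseteq> monomial_ideal V A"
    by (rule R.genideal_minimal[OF ideal_monomial_ideal])
  have carr: "monom ` A \<subseteq> carrier ?R"
    using gen monomial_ideal_carrier by (rule subset_trans[OF _ subsetI])
  have "ideal (Idl\<^bsub>?R\<^esub> (monom ` A)) ?R"
    using carr by (rule R.genideal_ideal)
  moreover have "monom ` A \<subseteq> Idl\<^bsub>?R\<^esub> (monom ` A)"
    using carr by (rule R.genideal_self)
  ultimately show "monomial_ideal V A \<subseteq> Idl\<^bsub>?R\<^esub> (monom ` A)"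
    by (rule monomial_ideal_subset)
qed

text \<open>A term of a product is a product of terms, which gives one inclusion; the other holds because
  the product ideal contains the products of the generators.\<close>

lemma prod_monomial_ideal:
  assumes A: "\<And>a. a \<in> A \<Longrightarrow> Poly_Mapping.keys a \<subseteq> V"
    and B: "\<And>b. b \<in> B \<Longrightarrow> Poly_Mapping.keys b \<subseteq> V"
  shows "(monomial_ideal V A :: ('v, 'k::comm_ring_1) mpoly set) \<cdot>\<^bsub>poly_ring V\<^esub> monomial_ideal V B
    = monomial_ideal V {a + b | a b. a \<in> A \<and> b \<in> B}" (is "?I \<cdot>\<^bsub>_\<^esub> ?J = ?K")
proof
  let ?R = "poly_ring V :: ('v, 'k) mpoly ring"
  interpret R: cring ?R by (rule poly_ring_cring)
  interpret K: ideal ?K ?R by (rule ideal_monomial_ideal)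
  show "?I \<cdot>\<^bsub>?R\<^esub> ?J \<subseteq> ?K"
  proof
    fix s assume "s \<in> ?I \<cdot>\<^bsub>?R\<^esub> ?J"
    then show "s \<in> ?K"
    proof (induction rule: ideal_prod.induct)
      case (prod i j)
      have "\<exists>d\<in>{a + b | a b. a \<in> A \<and> b \<in> B}. \<exists>c. m = d + c"
        if m: "m \<in> Poly_Mapping.keys (i * j)" for m
      proof -
        obtain s t where st: "s \<in> Poly_Mapping.keys i" "t \<in> Poly_Mapping.keys j" "m = s + t"
          using keys_multE[OF m] .
        obtain a c where a: "a \<in> A" "s = a + c"
          using monomial_idealE[OF prod(1) st(1)] .
        obtain b d where b: "b \<in> B" "t = b + d"
          using monomial_idealE[OF prod(2) st(2)] .
        have "m = (a + b) + (c + d)"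
          unfolding st(3) a(2) b(2) by (simp only: ac_simps)
        then show ?thesis using a(1) b(1) by blast
      qed
      moreover have "i \<otimes>\<^bsub>?R\<^esub> j \<in> carrier ?R"
        using prod by (intro R.m_closed monomial_ideal_carrier)
      ultimately show ?case unfolding monomial_ideal_def by simp
    next
      case (sum s1 s2)
      then show ?case using additive_subgroup.a_closed[OF K.additive_subgroup_axioms] by simp
    qed
  qed
  have "monom (a + b) \<in> ?I \<cdot>\<^bsub>?R\<^esub> ?J" if "a \<in> A" "b \<in> B" for a b
  proof -
    have "monom a \<in> ?I" "monom b \<in> ?J"
      using monom_mem_monomial_ideal[of a A 0 V] monom_mem_monomial_ideal[of b B 0 V] A B that
      by auto
    then show ?thesis using ideal_prod.prod[of "monom a" ?I "monom b" ?J ?R]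
      by (simp add: mult_single)
  qed
  then have "monom ` {a + b | a b. a \<in> A \<and> b \<in> B} \<subseteq> ?I \<cdot>\<^bsub>?R\<^esub> ?J"
    by blast
  then show "?K \<subseteq> ?I \<cdot>\<^bsub>?R\<^esub> ?J"
    by (rule monomial_ideal_subset[OF
          R.ideal_prod_is_ideal[OF ideal_monomial_ideal ideal_monomial_ideal]])
qed


section \<open>The irrelevant ideal as an associated prime\<close>

lemma irrelevant_ideal_eq_monomial_ideal:
  "(irrelevant_ideal V :: ('v, 'k::comm_ring_1) mpoly set)
    = monomial_ideal V ((\<lambda>i. Poly_Mapping.single i 1) ` V)"
proof -
  have "mvar ` V = (monom ` (\<lambda>i. Poly_Mapping.single i 1) ` V :: ('v, 'k) mpoly set)"
    by (auto simp: mvar_def)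
  then show ?thesis
    unfolding irrelevant_ideal_def by (subst genideal_monoms[symmetric]) auto
qed

lemma single_split:
  fixes m :: "'v \<Rightarrow>\<^sub>0 nat"
  assumes "i \<in> Poly_Mapping.keys m"
  obtains c where "m = Poly_Mapping.single i 1 + c"
proof
  show "m = Poly_Mapping.single i 1 + (m - Poly_Mapping.single i 1)"
    using assms
    by (intro poly_mapping_eqI) (auto simp: lookup_add lookup_minus lookup_single when_def in_keys_iff)
qed

text \<open>A monomial is divisible by some variable iff it is not 1, so the irrelevant ideal is the kernel
  of taking the constant term.\<close>

lemma mem_irrelevant_ideal:
  "p \<in> irrelevant_ideal V \<longleftrightarrow> p \<in> carrier (poly_ring V) \<and> Poly_Mapping.lookup p 0 = 0"
proof -
  have "(\<exists>i\<in>V. \<exists>c. m = Poly_Mapping.single i 1 + c) \<longleftrightarrow> m \<noteq> 0"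
    if "Poly_Mapping.keys m \<subseteq> V" for m :: "'a \<Rightarrow>\<^sub>0 nat"
  proof
    assume "\<exists>i\<in>V. \<exists>c. m = Poly_Mapping.single i 1 + c"
    then show "m \<noteq> 0" by (auto simp flip: keys_eq_empty simp: keys_add_nat)
  next
    assume "m \<noteq> 0"
    then obtain i where "i \<in> Poly_Mapping.keys m" by (auto simp flip: keys_eq_empty)
    then show "\<exists>i\<in>V. \<exists>c. m = Poly_Mapping.single i 1 + c"
      using that by (meson single_split subsetD)
  qed
  then have "p \<in> irrelevant_ideal V \<longleftrightarrow>
      p \<in> carrier (poly_ring V) \<and> (\<forall>m\<in>Poly_Mapping.keys p. m \<noteq> 0)"
    by (auto simp: irrelevant_ideal_eq_monomial_ideal monomial_ideal_def mem_poly_ring)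
  then show ?thesis by (auto simp: in_keys_iff)
qed

text \<open>Taking the constant term is multiplicative: after splitting off the constant terms of both
  factors, everything else in the product lies in the irrelevant ideal. Hence the kernel is prime
  over a field.\<close>

lemma primeideal_irrelevant_ideal:
  "primeideal (irrelevant_ideal V :: ('v, 'k::field) mpoly set) (poly_ring V)"
proof -
  let ?R = "poly_ring V :: ('v, 'k) mpoly ring"
  let ?m = "irrelevant_ideal V :: ('v, 'k) mpoly set"
  interpret R: cring ?R by (rule poly_ring_cring)
  interpret M: ideal ?m ?R
    unfolding irrelevant_ideal_eq_monomial_ideal by (rule ideal_monomial_ideal)
  have split: "\<exists>p'\<in>?m. p = Poly_Mapping.single 0 (Poly_Mapping.lookup p 0) + p'"
    if p: "p \<in> carrier ?R" for p
  proof
    have "p - Poly_Mapping.single 0 (Poly_Mapping.lookup p 0) \<in> carrier ?R"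
      unfolding mem_poly_ring
    proof
      fix m assume "m \<in> Poly_Mapping.keys (p - Poly_Mapping.single 0 (Poly_Mapping.lookup p 0))"
      then have "m \<in> Poly_Mapping.keys p"
        by (auto simp: in_keys_iff lookup_minus lookup_single when_def split: if_splits)
      then show "Poly_Mapping.keys m \<subseteq> V" using p by (simp add: mem_poly_ring)
    qed
    then show "p - Poly_Mapping.single 0 (Poly_Mapping.lookup p 0) \<in> ?m"
      by (simp add: mem_irrelevant_ideal lookup_minus)
  qed simp
  show ?thesis
  proof (rule primeidealI[OF M.ideal_axioms poly_ring_cring])
    show "carrier ?R \<noteq> ?m"
    proof
      assume "carrier ?R = ?m"
      then have "1 \<in> ?m" using R.one_closed by simp
      then show False by (simp add: mem_irrelevant_ideal lookup_one)
    qed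
  next
    fix a b
    assume a: "a \<in> carrier ?R" and b: "b \<in> carrier ?R" and ab: "a \<otimes>\<^bsub>?R\<^esub> b \<in> ?m"
    define \<alpha> \<beta> where "\<alpha> = Poly_Mapping.lookup a 0" and "\<beta> = Poly_Mapping.lookup b 0"
    obtain a' where a': "a' \<in> ?m" "a = Poly_Mapping.single 0 \<alpha> + a'"
      using split[OF a] by (auto simp: \<alpha>_def)
    obtain b' where b': "b' \<in> ?m" "b = Poly_Mapping.single 0 \<beta> + b'"
      using split[OF b] by (auto simp: \<beta>_def)
    have const: "Poly_Mapping.single 0 \<alpha> \<in> carrier ?R" by (simp add: mem_poly_ring)
    have "a * b = Poly_Mapping.single 0 \<alpha> * b + a' * b"
      by (simp only: a'(2) distrib_right)
    also have "Poly_Mapping.single 0 \<alpha> * b =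
        Poly_Mapping.single 0 (\<alpha> * \<beta>) + Poly_Mapping.single 0 \<alpha> * b'"
      by (simp only: b'(2) distrib_left mult_single add_0)
    finally have "a * b = Poly_Mapping.single 0 (\<alpha> * \<beta>) + (Poly_Mapping.single 0 \<alpha> * b' + a' * b)"
      by (simp only: add.assoc)
    moreover have "Poly_Mapping.single 0 \<alpha> * b' + a' * b \<in> ?m"
      using additive_subgroup.a_closed[OF M.additive_subgroup_axioms
          M.I_l_closed[OF b'(1) const] M.I_r_closed[OF a'(1) b]] by simp
    ultimately have "Poly_Mapping.lookup (a * b) 0 = \<alpha> * \<beta>"
      by (simp add: mem_irrelevant_ideal lookup_add)
    then show "a \<in> ?m \<or> b \<in> ?m"
      using ab a b by (auto simp: mem_irrelevant_ideal \<alpha>_def \<beta>_def)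
  qed
qed

text \<open>This removes the residue classes: annihilators in \<open>R/I\<close> are colon ideals in \<open>R\<close>.\<close>

lemma annihilator_quot_module:
  assumes "cring R" and "ideal I R" and y: "y \<in> carrier R"
  shows "annihilator R (quot_module R I) (I +>\<^bsub>R\<^esub> y) = {r \<in> carrier R. r \<otimes>\<^bsub>R\<^esub> y \<in> I}"
proof -
  interpret R: cring R by fact
  interpret I: ideal I R by fact
  have "(I +>\<^bsub>R\<^esub> r) \<otimes>\<^bsub>R Quot I\<^esub> (I +>\<^bsub>R\<^esub> y) = \<zero>\<^bsub>R Quot I\<^esub> \<longleftrightarrow> r \<otimes>\<^bsub>R\<^esub> y \<in> I"
    if "r \<in> carrier R" for r
    using that y I.rcos_const_imp_mem[of "r \<otimes>\<^bsub>R\<^esub> y"] I.a_rcos_const[of "r \<otimes>\<^bsub>R\<^esub> y"]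
    by (auto simp: FactRing_def I.rcoset_mult_add)
  then show ?thesis by (auto simp: annihilator_def quot_module_def)
qed

text \<open>The right-hand side asserts a socle exponent \<open>u\<close>. Given a witness \<open>y\<close>, some term \<open>x\<^sup>u\<close> of \<open>y\<close> is
  outside the monomial ideal, and \<open>x\<^sub>k x\<^sup>u\<close> is a term of \<open>x\<^sub>k y\<close>, hence inside. Conversely \<open>x\<^sup>u\<close> itself
  is a witness: a polynomial with nonzero constant term cannot annihilate its class, because the
  term \<open>x\<^sup>u\<close> survives in the product.\<close>

lemma associated_prime_irrelevant_ideal_iff:
  assumes A: "\<And>a. a \<in> A \<Longrightarrow> Poly_Mapping.keys a \<subseteq> V"
  shows "associated_prime (poly_ring V)
      (quot_module (poly_ring V) (monomial_ideal V A :: ('v, 'k::field) mpoly set)) (irrelevant_ideal V)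
    \<longleftrightarrow> (\<exists>u. Poly_Mapping.keys u \<subseteq> V \<and> (\<forall>a\<in>A. \<forall>c. u \<noteq> a + c) \<and>
          (\<forall>k\<in>V. \<exists>a\<in>A. \<exists>c. Poly_Mapping.single k 1 + u = a + c))" (is "?L \<longleftrightarrow> ?E")
proof -
  let ?R = "poly_ring V :: ('v, 'k) mpoly ring"
  let ?I = "monomial_ideal V A :: ('v, 'k) mpoly set"
  let ?m = "irrelevant_ideal V :: ('v, 'k) mpoly set"
  interpret R: cring ?R by (rule poly_ring_cring)
  interpret I: ideal ?I ?R by (rule ideal_monomial_ideal)
  interpret M: primeideal ?m ?R by (rule primeideal_irrelevant_ideal)
  have car: "carrier (quot_module ?R ?I) = (+>\<^bsub>?R\<^esub>) ?I ` carrier ?R"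
    by (auto simp: quot_module_def FactRing_def A_RCOSETS_def')
  have var: "monom (Poly_Mapping.single k 1) \<in> ?m" if "k \<in> V" for k
    using that unfolding irrelevant_ideal_eq_monomial_ideal
    by (intro monom_mem_monomial_ideal[where c = 0, simplified]) auto
  have "?L \<longleftrightarrow> (\<exists>y\<in>carrier ?R. ?m = {r \<in> carrier ?R. r * y \<in> ?I})"
    unfolding associated_prime_def car
    using M.primeideal annihilator_quot_module[OF poly_ring_cring I.ideal_axioms] by simp
  also have "\<dots> \<longleftrightarrow> ?E"
  proof
    assume "\<exists>y\<in>carrier ?R. ?m = {r \<in> carrier ?R. r * y \<in> ?I}"
    then obtain y where y: "y \<in> carrier ?R" and "?m = {r \<in> carrier ?R. r * y \<in> ?I}" by blast
    then have m: "r \<in> ?m \<longleftrightarrow> r \<in> carrier ?R \<and> r * y \<in> ?I" for r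
      by blast
    have "1 \<in> carrier ?R" "1 \<notin> ?m"
      using R.one_closed by (auto simp: mem_irrelevant_ideal lookup_one)
    then have "y \<notin> ?I" using m[of 1] by simp
    then obtain u where u: "u \<in> Poly_Mapping.keys y" "\<forall>a\<in>A. \<forall>c. u \<noteq> a + c"
      using y unfolding monomial_ideal_def by blast
    moreover have "Poly_Mapping.keys u \<subseteq> V" using u(1) y by (auto simp: mem_poly_ring)
    moreover have "\<exists>a\<in>A. \<exists>c. Poly_Mapping.single k 1 + u = a + c" if "k \<in> V" for k
    proof -
      have "monom (Poly_Mapping.single k 1) * y \<in> ?I" using var[OF that] m by blast
      moreover have "Poly_Mapping.single k 1 + u \<in>
          Poly_Mapping.keys (monom (Poly_Mapping.single k 1) * y)"
        using u(1) by (simp add: in_keys_iff lookup_monom_mult)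
      ultimately show ?thesis unfolding monomial_ideal_def by blast
    qed
    ultimately show ?E by blast
  next
    assume ?E
    then obtain u where u: "Poly_Mapping.keys u \<subseteq> V" "\<forall>a\<in>A. \<forall>c. u \<noteq> a + c"
      and k: "\<And>k. k \<in> V \<Longrightarrow> \<exists>a\<in>A. \<exists>c. Poly_Mapping.single k 1 + u = a + c" by blast
    have car: "monom u \<in> carrier ?R" using u by (simp add: mem_poly_ring)
    have "r * monom u \<in> ?I" if "r \<in> ?m" for r
    proof -
      have "r * monom u \<in> carrier ?R"
        using R.m_closed[of r "monom u"] car that by (simp add: mem_irrelevant_ideal)
      moreover have "\<exists>a\<in>A. \<exists>c. m = a + c" if m: "m \<in> Poly_Mapping.keys (r * monom u)" for m
      proof -
        obtain s where s: "m = s + u" "s \<in> Poly_Mapping.keys r"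
          using m by (rule keys_multE) simp
        with \<open>r \<in> ?m\<close> obtain i d where i: "i \<in> V" and d: "s = Poly_Mapping.single i 1 + d"
          unfolding irrelevant_ideal_eq_monomial_ideal monomial_ideal_def by blast
        obtain a c where a: "a \<in> A" and c: "Poly_Mapping.single i 1 + u = a + c"
          using k[OF i] by blast
        have "m = (Poly_Mapping.single i 1 + u) + d"
          unfolding s(1) d by (simp only: ac_simps)
        then have "m = a + (c + d)"
          unfolding c by (simp only: add.assoc)
        with a show ?thesis by blast
      qed
      ultimately show ?thesis unfolding monomial_ideal_def by blast
    qed
    moreover have "r \<in> ?m" if r: "r \<in> carrier ?R" "r * monom u \<in> ?I" for r
    proof -
      have "u \<notin> Poly_Mapping.keys (r * monom u)"
        using r(2) u(2) unfolding monomial_ideal_def by blast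
      then have "Poly_Mapping.lookup r 0 = 0"
        using lookup_monom_mult[of u r 0] by (simp add: in_keys_iff mult.commute)
      with r(1) show ?thesis by (simp add: mem_irrelevant_ideal)
    qed
    moreover have "?m \<subseteq> carrier ?R"
      by (auto simp only: mem_irrelevant_ideal)
    ultimately have "?m = {r \<in> carrier ?R. r * monom u \<in> ?I}"
      by blast
    with car show "\<exists>y\<in>carrier ?R. ?m = {r \<in> carrier ?R. r * y \<in> ?I}" by blast
  qed
  finally show ?thesis .
qed


section \<open>Squares of squarefree monomial ideals\<close>

definition indicator_exponent :: "'v set \<Rightarrow> 'v \<Rightarrow>\<^sub>0 nat" where
  "indicator_exponent W = (\<Sum>j\<in>W. Poly_Mapping.single j 1)"

lemma lookup_indicator_exponent:
  "finite W \<Longrightarrow> Poly_Mapping.lookup (indicator_exponent W) j = of_bool (j \<in> W)"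
  by (auto simp: indicator_exponent_def lookup_sum lookup_single when_def)

lemma keys_indicator_exponent:
  "finite W \<Longrightarrow> Poly_Mapping.keys (indicator_exponent W) = W"
  by (auto simp: in_keys_iff lookup_indicator_exponent)

lemma squarefree_monom_eq: "squarefree_monom W = monom (indicator_exponent W)"
  by (induction W rule: infinite_finite_induct)
    (auto simp: squarefree_monom_def indicator_exponent_def mvar_def mult_single)

lemma exponent_divides_iff:
  fixes a m :: "'v \<Rightarrow>\<^sub>0 nat"
  shows "(\<exists>c. m = a + c) \<longleftrightarrow> (\<forall>l. Poly_Mapping.lookup a l \<le> Poly_Mapping.lookup m l)"
proof
  assume "\<forall>l. Poly_Mapping.lookup a l \<le> Poly_Mapping.lookup m l"
  then have "m = a + (m - a)"
    by (intro poly_mapping_eqI) (simp add: lookup_add lookup_minus)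
  then show "\<exists>c. m = a + c" ..
qed (auto simp: lookup_add)

text \<open>The key point is that a socle exponent of the square is the indicator of a set: a generator
  that divides \<open>x\<^sub>k x\<^sup>u\<close> but not \<open>x\<^sup>u\<close> has exponent \<open>u k + 1\<close> at \<open>k\<close>, and exponents of generators are at
  most 2. The set \<open>C\<close> below is the zero set of \<open>u\<close>. Away from \<open>k\<close> the generator has exponents
  at most 1. If \<open>k \<in> C\<close>, its exponent at \<open>k\<close> is 1, so \<open>N i\<close> and \<open>N j\<close> are disjoint; if \<open>k \<notin> C\<close>, it is 2, so
  they meet in \<open>k\<close> only.\<close>

lemma socle_exponent_iff_cover:
  fixes N :: "'i \<Rightarrow> 'v set"
  assumes V: "finite V" and N: "\<And>i. i \<in> J \<Longrightarrow> N i \<subseteq> V"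
  defines "A \<equiv> {indicator_exponent (N i) + indicator_exponent (N j) | i j. i \<in> J \<and> j \<in> J}"
  shows "(\<exists>u. Poly_Mapping.keys u \<subseteq> V \<and> (\<forall>a\<in>A. \<forall>c. u \<noteq> a + c) \<and>
            (\<forall>k\<in>V. \<exists>a\<in>A. \<exists>c. Poly_Mapping.single k 1 + u = a + c))
    \<longleftrightarrow> (\<exists>C\<subseteq>V. (\<forall>i\<in>J. \<forall>j\<in>J. N i \<inter> N j = {} \<longrightarrow> C \<inter> (N i \<union> N j) \<noteq> {}) \<and>
          (\<forall>k\<in>C. \<exists>i\<in>J. \<exists>j\<in>J. N i \<inter> N j = {} \<and> C \<inter> (N i \<union> N j) = {k}) \<and>
          (\<forall>k\<in>V - C. \<exists>i\<in>J. \<exists>j\<in>J. N i \<subseteq> V - C \<and> N j \<subseteq> V - C \<and> N i \<inter> N j = {k}))"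
    (is "?L \<longleftrightarrow> ?R")
proof -
  have fin: "finite (N i)" if "i \<in> J" for i using V N[OF that] by (rule rev_finite_subset)
  \<comment> \<open>Divisibility is compared one coordinate at a time, which turns it into membership in the \<open>N i\<close>.\<close>
  define le where "le i j w \<longleftrightarrow> (\<forall>l. of_bool (l \<in> N i) + of_bool (l \<in> N j) \<le> (w l :: nat))" for i j w
  have dvd: "(\<exists>a\<in>A. \<exists>c. m = a + c) \<longleftrightarrow> (\<exists>i\<in>J. \<exists>j\<in>J. le i j (Poly_Mapping.lookup m))" for m
  proof -
    have "(\<exists>a\<in>A. \<exists>c. m = a + c) \<longleftrightarrow>
        (\<exists>i\<in>J. \<exists>j\<in>J. \<exists>c. m = (indicator_exponent (N i) + indicator_exponent (N j)) + c)"
      unfolding A_def by blast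
    also have "\<dots> \<longleftrightarrow> (\<exists>i\<in>J. \<exists>j\<in>J. le i j (Poly_Mapping.lookup m))"
      unfolding exponent_divides_iff le_def
      by (intro bex_cong refl) (simp add: lookup_add lookup_indicator_exponent fin)
    finally show ?thesis .
  qed
  let ?up = "\<lambda>k u l. of_bool (l = k) + Poly_Mapping.lookup u l"
  have L: "?L \<longleftrightarrow> (\<exists>u. Poly_Mapping.keys u \<subseteq> V \<and> (\<forall>i\<in>J. \<forall>j\<in>J. \<not> le i j (Poly_Mapping.lookup u)) \<and>
      (\<forall>k\<in>V. \<exists>i\<in>J. \<exists>j\<in>J. le i j (?up k u)))"
  proof -
    have "Poly_Mapping.lookup (Poly_Mapping.single k 1 + u) = ?up k u" for k and u :: "'v \<Rightarrow>\<^sub>0 nat"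
      by (auto simp: lookup_add lookup_single when_def)
    moreover have "(\<forall>a\<in>A. \<forall>c. u \<noteq> a + c) \<longleftrightarrow> \<not> (\<exists>a\<in>A. \<exists>c. u = a + c)" for u by blast
    ultimately show ?thesis by (simp add: dvd)
  qed
  show ?thesis unfolding L
  proof
    assume "\<exists>u. Poly_Mapping.keys u \<subseteq> V \<and> (\<forall>i\<in>J. \<forall>j\<in>J. \<not> le i j (Poly_Mapping.lookup u)) \<and>
      (\<forall>k\<in>V. \<exists>i\<in>J. \<exists>j\<in>J. le i j (?up k u))"
    then obtain u where uV: "Poly_Mapping.keys u \<subseteq> V"
      and not: "\<And>i j. i \<in> J \<Longrightarrow> j \<in> J \<Longrightarrow> \<not> le i j (Poly_Mapping.lookup u)"
      and up: "\<And>k. k \<in> V \<Longrightarrow> \<exists>i\<in>J. \<exists>j\<in>J. le i j (?up k u)" by blast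
    let ?u = "Poly_Mapping.lookup u"
    define C where "C = {k \<in> V. ?u k = 0}"
    have tight: "\<exists>i\<in>J. \<exists>j\<in>J. Suc (?u k) = of_bool (k \<in> N i) + of_bool (k \<in> N j) \<and>
        (\<forall>l. l \<noteq> k \<longrightarrow> of_bool (l \<in> N i) + of_bool (l \<in> N j) \<le> ?u l)" if k: "k \<in> V" for k
    proof -
      obtain i j where ij: "i \<in> J" "j \<in> J" "le i j (?up k u)" using up[OF k] by blast
      obtain l where l: "\<not> of_bool (l \<in> N i) + of_bool (l \<in> N j) \<le> ?u l"
        using not[OF ij(1,2)] unfolding le_def by blast
      have le: "of_bool (l \<in> N i) + of_bool (l \<in> N j) \<le> ?up k u l" for l
        using ij(3) unfolding le_def by blast
      have "l = k" using l le[of l] by (cases "l = k") auto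
      then have "Suc (?u k) = of_bool (k \<in> N i) + of_bool (k \<in> N j)"
        using l le[of k] by simp
      moreover have "\<forall>l. l \<noteq> k \<longrightarrow> of_bool (l \<in> N i) + of_bool (l \<in> N j) \<le> ?u l"
        using le by (metis add_0 of_bool_eq(1))
      ultimately show ?thesis using ij by blast
    qed
    have u01: "?u k = of_bool (k \<in> V - C)" for k
    proof (cases "k \<in> V")
      case True
      then obtain i j where "Suc (?u k) = of_bool (k \<in> N i) + of_bool (k \<in> N j)"
        using tight by blast
      then have "?u k \<le> 1" by (auto simp: of_bool_def split: if_splits)
      then show ?thesis using True by (auto simp: C_def)
    next
      case False
      then show ?thesis using uV by (auto simp: in_keys_iff)
    qed
    \<comment> \<open>A generator fails to divide \<open>x\<^sup>u\<close> either at a zero of \<open>u\<close> or where its own exponent is 2.\<close>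
    have cover: "\<exists>l. l \<in> C \<and> (l \<in> N i \<or> l \<in> N j) \<or> l \<in> N i \<and> l \<in> N j" if "i \<in> J" "j \<in> J" for i j
    proof (rule ccontr)
      assume "\<not> ?thesis"
      then have "le i j ?u"
        using N that unfolding le_def u01 of_bool_def by auto
      with not that show False by blast
    qed
    show ?R
    proof (intro exI[of _ C] conjI ballI impI)
      show "C \<subseteq> V" by (auto simp: C_def)
    next
      fix i j assume "i \<in> J" "j \<in> J" "N i \<inter> N j = {}"
      then show "C \<inter> (N i \<union> N j) \<noteq> {}" using cover[of i j] by blast
    next
      fix k assume k: "k \<in> C"
      then have "k \<in> V" by (simp add: C_def)
      then obtain i j where ij: "i \<in> J" "j \<in> J"
        and eq: "Suc (?u k) = of_bool (k \<in> N i) + of_bool (k \<in> N j)"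
        and le: "\<And>l. l \<noteq> k \<Longrightarrow> of_bool (l \<in> N i) + of_bool (l \<in> N j) \<le> ?u l"
        using tight by blast
      have "k \<in> N i \<union> N j" "k \<notin> N i \<inter> N j"
        using eq k by (auto simp: u01 of_bool_def split: if_splits)
      moreover have "l \<notin> C \<and> l \<notin> N i \<inter> N j" if "l \<in> N i \<union> N j" "l \<noteq> k" for l
        using le[of l] that by (auto simp: u01 of_bool_def split: if_splits)
      ultimately have "N i \<inter> N j = {}" "C \<inter> (N i \<union> N j) = {k}"
        using k by blast+
      with ij show "\<exists>i\<in>J. \<exists>j\<in>J. N i \<inter> N j = {} \<and> C \<inter> (N i \<union> N j) = {k}"
        by blast
    next
      fix k assume k: "k \<in> V - C"
      then obtain i j where ij: "i \<in> J" "j \<in> J"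
        and eq: "Suc (?u k) = of_bool (k \<in> N i) + of_bool (k \<in> N j)"
        and le: "\<And>l. l \<noteq> k \<Longrightarrow> of_bool (l \<in> N i) + of_bool (l \<in> N j) \<le> ?u l"
        using tight by blast
      have "k \<in> N i" "k \<in> N j"
        using eq k by (auto simp: u01 of_bool_def split: if_splits)
      moreover have "l \<in> V - C \<and> l \<notin> N i \<inter> N j" if "l \<in> N i \<union> N j" "l \<noteq> k" for l
        using le[of l] that by (auto simp: u01 of_bool_def split: if_splits)
      ultimately have "N i \<subseteq> V - C" "N j \<subseteq> V - C" "N i \<inter> N j = {k}"
        using k by blast+
      with ij show "\<exists>i\<in>J. \<exists>j\<in>J. N i \<subseteq> V - C \<and> N j \<subseteq> V - C \<and> N i \<inter> N j = {k}"
        by blast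
    qed
  next
    assume ?R
    then obtain C where C: "C \<subseteq> V"
      and cover: "\<forall>i\<in>J. \<forall>j\<in>J. N i \<inter> N j = {} \<longrightarrow> C \<inter> (N i \<union> N j) \<noteq> {}"
      and inC: "\<forall>k\<in>C. \<exists>i\<in>J. \<exists>j\<in>J. N i \<inter> N j = {} \<and> C \<inter> (N i \<union> N j) = {k}"
      and outC: "\<forall>k\<in>V - C. \<exists>i\<in>J. \<exists>j\<in>J. N i \<subseteq> V - C \<and> N j \<subseteq> V - C \<and> N i \<inter> N j = {k}"
      by (elim exE conjE) (rule that)
    define u where "u = indicator_exponent (V - C)"
    have u: "Poly_Mapping.lookup u l = of_bool (l \<in> V - C)" for l
      using V by (simp add: u_def lookup_indicator_exponent)
    have "Poly_Mapping.keys u \<subseteq> V"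
      using V by (auto simp: u_def keys_indicator_exponent)
    moreover have "\<not> le i j (Poly_Mapping.lookup u)" if ij: "i \<in> J" "j \<in> J" for i j
    proof
      assume "le i j (Poly_Mapping.lookup u)"
      then have le: "of_bool (l \<in> N i) + of_bool (l \<in> N j) \<le> (of_bool (l \<in> V - C) :: nat)" for l
        by (simp only: le_def u)
      have "N i \<inter> N j = {}" "C \<inter> (N i \<union> N j) = {}"
        using le by (force simp: of_bool_def split: if_splits)+
      then show False using cover ij by blast
    qed
    moreover have "\<exists>i\<in>J. \<exists>j\<in>J. le i j (?up k u)" if k: "k \<in> V" for k
    proof (cases "k \<in> C")
      case True
      then obtain i j where ij: "i \<in> J" "j \<in> J" "N i \<inter> N j = {}" "C \<inter> (N i \<union> N j) = {k}"
        using inC by blast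
      then have "le i j (?up k u)"
        unfolding le_def u of_bool_def using N by auto
      with ij show ?thesis by blast
    next
      case False
      then obtain i j where ij: "i \<in> J" "j \<in> J" "N i \<subseteq> V - C" "N j \<subseteq> V - C" "N i \<inter> N j = {k}"
        using outC k by blast
      then have "le i j (?up k u)"
        unfolding le_def u of_bool_def using k False by auto
      with ij show ?thesis by blast
    qed
    ultimately show "\<exists>u. Poly_Mapping.keys u \<subseteq> V \<and>
        (\<forall>i\<in>J. \<forall>j\<in>J. \<not> le i j (Poly_Mapping.lookup u)) \<and>
        (\<forall>k\<in>V. \<exists>i\<in>J. \<exists>j\<in>J. le i j (?up k u))" by blast
  qed
qed


section \<open>Short distances and closed neighborhoods\<close>

lemma closed_nbhd_subset_verts:
  assumes "wf_digraph G" and "i \<in> verts G"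
  shows "closed_nbhd G i \<subseteq> verts G"
  using assms wf_digraph.wellformed[of G]
  by (auto simp: closed_nbhd_def nbhd_def arcs_ends_def arc_to_ends_def wf_digraph.head_in_verts)

lemma le_gdist_iff:
  assumes "wf_digraph G"
  shows "ereal (real k) \<le> gdist G u v \<longleftrightarrow> (\<forall>p. pre_digraph.awalk G u p v \<longrightarrow> k \<le> length p)"
proof -
  interpret wf_digraph G by fact
  have "awalk_cost (\<lambda>_. 1) p = length p" for p
    by (induction p) auto
  then show ?thesis
    by (auto simp: gdist_def \<mu>_def le_INF_iff)
qed

lemma arcs_ends_iff:
  "(u, v) \<in> arcs_ends G \<longleftrightarrow> (\<exists>e\<in>arcs G. tail G e = u \<and> head G e = v)"
  by (auto simp: arcs_ends_def arc_to_ends_def)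

lemma two_le_gdist_iff:
  assumes wf: "wf_digraph G" and u: "u \<in> verts G"
  shows "2 \<le> gdist G u v \<longleftrightarrow> v \<notin> closed_nbhd G u"
proof -
  interpret wf_digraph G by fact
  have "2 \<le> gdist G u v \<longleftrightarrow> (\<forall>p. awalk u p v \<longrightarrow> 2 \<le> length p)"
    using le_gdist_iff[OF wf, of 2] by simp
  also have "\<dots> \<longleftrightarrow> \<not> awalk u [] v \<and> (\<forall>e. \<not> awalk u [e] v)"
    (is "?A \<longleftrightarrow> ?B")
  proof
    assume A: ?A
    show ?B using A[rule_format, of "[]"] A[rule_format, of "[_]"] by auto
  next
    assume B: ?B
    have "p = [] \<or> (\<exists>e. p = [e])" if "\<not> 2 \<le> length p" for p :: "'b list"
      using that by (cases p; cases "tl p") auto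
    with B show ?A by metis
  qed
  also have "\<dots> \<longleftrightarrow> v \<notin> closed_nbhd G u"
    using u by (auto simp: awalk_simps closed_nbhd_def nbhd_def arcs_ends_iff)
  finally show ?thesis .
qed

text \<open>A common element of the two closed neighborhoods is the middle vertex of a walk of length at most
  2, where the middle vertex may coincide with an end.\<close>

lemma three_le_gdist_iff:
  assumes wf: "wf_digraph G" and sym: "symmetric G" and u: "u \<in> verts G" and v: "v \<in> verts G"
  shows "3 \<le> gdist G u v \<longleftrightarrow> closed_nbhd G u \<inter> closed_nbhd G v = {}"
proof -
  interpret wf_digraph G by fact
  have swap: "(a, b) \<in> arcs_ends G \<longleftrightarrow> (b, a) \<in> arcs_ends G" for a b
    using sym by (auto simp: symmetric_def dest: symD)
  have "3 \<le> gdist G u v \<longleftrightarrow> (\<forall>p. awalk u p v \<longrightarrow> 3 \<le> length p)"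
    using le_gdist_iff[OF wf, of 3] by simp
  also have "\<dots> \<longleftrightarrow> \<not> (\<exists>p. awalk u p v \<and> length p \<le> 2)"
    by (auto simp: not_le numeral_3_eq_3 numeral_2_eq_2)
  also have "\<dots> \<longleftrightarrow> \<not> (awalk u [] v \<or> (\<exists>e. awalk u [e] v) \<or> (\<exists>e f. awalk u [e, f] v))"
    by (auto simp: numeral_2_eq_2 le_Suc_eq length_Suc_conv intro: exI[of _ "[]"] exI[of _ "[_]"] exI[of _ "[_, _]"])
  also have "\<dots> \<longleftrightarrow> \<not> (u = v \<or> (u, v) \<in> arcs_ends G \<or>
      (\<exists>w. (u, w) \<in> arcs_ends G \<and> (w, v) \<in> arcs_ends G))"
    using u v by (auto simp: awalk_simps arcs_ends_iff)
  also have "\<dots> \<longleftrightarrow> closed_nbhd G u \<inter> closed_nbhd G v = {}"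
    using swap by (auto simp: closed_nbhd_def nbhd_def)
  finally show ?thesis .
qed

lemma arcs_ends_del_vert:
  "(a, b) \<in> arcs_ends (pre_digraph.del_vert G k) \<longleftrightarrow> (a, b) \<in> arcs_ends G \<and> a \<noteq> k \<and> b \<noteq> k"
  by (auto simp: arcs_ends_iff pre_digraph.del_vert_def)

text \<open>Suppose that the intersection is \<open>{k}\<close>. Then \<open>i = j\<close> would make \<open>i\<close> isolated, and \<open>i = k\<close> would make
  \<open>j\<close> a neighbor of \<open>k\<close> and so a second element of the intersection; by symmetry \<open>j \<noteq> k\<close>, and \<open>i\<close>
  and \<open>j\<close> are neighbors of \<open>k\<close>. For vertices other than \<open>k\<close>, removing \<open>k\<close> from the graph just removes
  it from their closed neighborhoods.\<close>

lemma closed_nbhd_Int_eq_singleton_iff: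
  assumes G: "graph G"
    and i: "i \<in> verts G" and j: "j \<in> verts G" and k: "k \<in> verts G"
    and no_isolated: "\<And>v. v \<in> verts G \<Longrightarrow> closed_nbhd G v \<noteq> {v}"
  shows "closed_nbhd G i \<inter> closed_nbhd G j = {k} \<longleftrightarrow>
    i \<in> nbhd G k \<and> j \<in> nbhd G k \<and> gdist G i j = 2 \<and>
    3 \<le> gdist (pre_digraph.del_vert G k) i j"
proof -
  interpret graph G by fact
  let ?D = "del_vert k"
  have wfD: "wf_digraph ?D" by (rule wf_digraph_del_vert)
  have swap: "(a, b) \<in> arcs_ends G \<longleftrightarrow> (b, a) \<in> arcs_ends G" for a b
    using sym_arcs by (auto simp: symmetric_def dest: symD)
  have self: "v \<in> closed_nbhd G v" for v
    by (simp add: closed_nbhd_def)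
  have flip: "a \<in> closed_nbhd G b \<longleftrightarrow> b \<in> closed_nbhd G a" for a b
    using swap unfolding closed_nbhd_def nbhd_def by blast
  have loop: "(a, a) \<notin> arcs_ends G" for a
    using no_loops unfolding arcs_ends_iff by metis
  have symD: "symmetric ?D"
    using swap by (auto simp: symmetric_def sym_def arcs_ends_del_vert)
  have del: "closed_nbhd ?D v = closed_nbhd G v - {k}" if "v \<noteq> k" for v
    using that by (auto simp: closed_nbhd_def nbhd_def arcs_ends_del_vert)
  have three: "3 \<le> gdist ?D i j \<longleftrightarrow> closed_nbhd G i \<inter> closed_nbhd G j \<subseteq> {k}"
    if "i \<noteq> k" "j \<noteq> k"
    using three_le_gdist_iff[OF wfD symD, of i j] that i j by (auto simp: del verts_del_vert)
  have two: "gdist G i j = 2 \<longleftrightarrow> j \<notin> closed_nbhd G i"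
    if inter: "closed_nbhd G i \<inter> closed_nbhd G j \<noteq> {}"
  proof -
    have "gdist G i j \<le> 2" if far: "j \<notin> closed_nbhd G i"
    proof -
      obtain w where "(i, w) \<in> arcs_ends G" "(w, j) \<in> arcs_ends G"
        using inter far swap by (auto simp: closed_nbhd_def nbhd_def)
      then obtain e f where "e \<in> arcs G" "tail G e = i" "head G e = w"
        "f \<in> arcs G" "tail G f = w" "head G f = j"
        unfolding arcs_ends_iff by blast
      then have "awalk i [e, f] j"
        using i j by (simp add: awalk_simps)
      then have "gdist G i j \<le> ereal (awalk_cost (\<lambda>_. 1) [e, f])"
        unfolding gdist_def by (rule min_cost_le_walk_cost)
      then show ?thesis by simp
    qed
    then show ?thesis
      using two_le_gdist_iff[OF wf_digraph_axioms i, of j] by (auto intro: antisym)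
  qed
  show ?thesis
  proof
    assume eq: "closed_nbhd G i \<inter> closed_nbhd G j = {k}"
    have mem: "k \<in> closed_nbhd G i" "k \<in> closed_nbhd G j"
      using eq by blast+
    have ij: "i \<noteq> j"
    proof
      assume "i = j"
      then have "closed_nbhd G i = {k}" using eq by simp
      then show False using self[of i] no_isolated[OF i] by simp
    qed
    have "i \<noteq> k"
    proof
      assume "i = k"
      then have "j \<in> closed_nbhd G i \<inter> closed_nbhd G j"
        using mem(2) flip self by blast
      then have "j = k" unfolding eq by simp
      with \<open>i = k\<close> ij show False by simp
    qed
    moreover have "j \<noteq> k"
    proof
      assume "j = k"
      then have "i \<in> closed_nbhd G i \<inter> closed_nbhd G j"
        using mem(1) flip self by blast
      then have "i = k" unfolding eq by simp
      with \<open>j = k\<close> ij show False by simp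
    qed
    moreover have "j \<notin> closed_nbhd G i"
      using eq \<open>j \<noteq> k\<close> self by blast
    moreover have "i \<in> nbhd G k" "j \<in> nbhd G k"
      using mem flip \<open>i \<noteq> k\<close> \<open>j \<noteq> k\<close> unfolding closed_nbhd_def by blast+
    ultimately show "i \<in> nbhd G k \<and> j \<in> nbhd G k \<and> gdist G i j = 2 \<and> 3 \<le> gdist ?D i j"
      using two three mem eq by blast
  next
    assume R: "i \<in> nbhd G k \<and> j \<in> nbhd G k \<and> gdist G i j = 2 \<and> 3 \<le> gdist ?D i j"
    then have "i \<noteq> k" "j \<noteq> k" using loop unfolding nbhd_def by blast+
    moreover have "k \<in> closed_nbhd G i" "k \<in> closed_nbhd G j"
      using R flip unfolding closed_nbhd_def by blast+
    ultimately show "closed_nbhd G i \<inter> closed_nbhd G j = {k}"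
      using R three by blast
  qed
qed

text \<open>An isolated vertex of a connected graph is the only vertex, and then the diameter is 0.\<close>

lemma closed_nbhd_ne_singleton:
  assumes G: "graph G" and conn: "Digraph_Component.connected G" and diam: "0 < diam G"
    and v: "v \<in> verts G"
  shows "closed_nbhd G v \<noteq> {v}"
proof
  interpret graph G by fact
  assume iso: "closed_nbhd G v = {v}"
  have "w = v" if w: "w \<in> verts G" for w
  proof -
    have "v \<rightarrow>\<^sup>*\<^bsub>mk_symmetric G\<^esub> w"
      using conn v w unfolding connected_def strongly_connected_def by simp
    then have "v \<rightarrow>\<^sup>*\<^bsub>G\<^esub> w" by (simp only: reachable_mk_symmetric_eq[OF sym_arcs])
    then show ?thesis
    proof (cases rule: converse_reachable_cases)
      case (step x)
      then have "x \<in> closed_nbhd G v" by (simp add: closed_nbhd_def nbhd_def)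
      then have "x = v" using iso by simp
      then have "(v, v) \<in> arcs_ends G" using step by simp
      then show ?thesis using no_loops unfolding arcs_ends_iff by metis
    qed simp
  qed
  then have "verts G = {v}" using v by blast
  moreover have "gdist G v v \<le> 0"
    using min_cost_le_walk_cost[of v "[]" v "\<lambda>_. 1"] v
    by (simp add: awalk_Nil_iff gdist_def zero_ereal_def)
  ultimately have "diam G \<le> 0" by (simp add: diam_def)
  with diam show False by simp
qed


section \<open>The criterion for closed neighborhood ideals\<close>

text \<open>The criterion for the square of an arbitrary squarefree monomial ideal. For closed neighborhoods,
  distances serve to express when two closed neighborhoods are disjoint or meet in one vertex.\<close>

lemma associated_prime_square_squarefree_iff:
  fixes N :: "'i \<Rightarrow> 'v set" and J :: "'i set"
  assumes V: "finite V" and N: "\<And>i. i \<in> J \<Longrightarrow> N i \<subseteq> V"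
  defines "S \<equiv> poly_ring V :: ('v, 'k::field) mpoly ring"
    and "I \<equiv> Idl\<^bsub>poly_ring V\<^esub> ((\<lambda>i. squarefree_monom (N i)) ` J) :: ('v, 'k) mpoly set"
  shows "associated_prime S (quot_module S (I \<cdot>\<^bsub>S\<^esub> I)) (irrelevant_ideal V)
    \<longleftrightarrow> (\<exists>C\<subseteq>V. (\<forall>i\<in>J. \<forall>j\<in>J. N i \<inter> N j = {} \<longrightarrow> C \<inter> (N i \<union> N j) \<noteq> {}) \<and>
          (\<forall>k\<in>C. \<exists>i\<in>J. \<exists>j\<in>J. N i \<inter> N j = {} \<and> C \<inter> (N i \<union> N j) = {k}) \<and>
          (\<forall>k\<in>V - C. \<exists>i\<in>J. \<exists>j\<in>J. N i \<subseteq> V - C \<and> N j \<subseteq> V - C \<and> N i \<inter> N j = {k}))"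
proof -
  let ?B = "(\<lambda>i. indicator_exponent (N i)) ` J"
  have keys: "Poly_Mapping.keys b \<subseteq> V" if "b \<in> ?B" for b
  proof -
    from that obtain i where i: "i \<in> J" "b = indicator_exponent (N i)" by blast
    then show ?thesis
      using N[OF i(1)] keys_indicator_exponent[OF finite_subset[OF N[OF i(1)] V]] by simp
  qed
  have "(\<lambda>i. squarefree_monom (N i)) ` J = (monom ` ?B :: ('v, 'k) mpoly set)"
    by (auto simp: squarefree_monom_eq)
  then have "I = monomial_ideal V ?B"
    unfolding I_def by (simp only: genideal_monoms[OF keys])
  then have "I \<cdot>\<^bsub>S\<^esub> I = monomial_ideal V {a + b | a b. a \<in> ?B \<and> b \<in> ?B}"
    unfolding S_def by (simp only: prod_monomial_ideal[OF keys keys])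
  also have "{a + b | a b. a \<in> ?B \<and> b \<in> ?B} =
      {indicator_exponent (N i) + indicator_exponent (N j) | i j. i \<in> J \<and> j \<in> J}" by blast
  finally have II: "I \<cdot>\<^bsub>S\<^esub> I = monomial_ideal V
      {indicator_exponent (N i) + indicator_exponent (N j) | i j. i \<in> J \<and> j \<in> J}" .
  have "Poly_Mapping.keys a \<subseteq> V"
    if "a \<in> {indicator_exponent (N i) + indicator_exponent (N j) | i j. i \<in> J \<and> j \<in> J}" for a
    using that keys by (fastforce simp: keys_add_nat)
  then show ?thesis
    unfolding II[unfolded S_def] S_def
    by (rule trans[OF associated_prime_irrelevant_ideal_iff socle_exponent_iff_cover])
      (use V N in blast)+
qed

theorem theorem1p4:
  fixes n :: nat
    and G :: "(nat, 'e) pre_digraph"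
    and S :: "(nat, 'k::field) mpoly ring"
    and NI \<mm> :: "(nat, 'k) mpoly set"
    and H :: "nat hypergraph"
  assumes "graph G"
    and "verts G = {1..n}"
    and "Digraph_Component.connected G"
    and "diam G \<ge> 3"
  defines "S \<equiv> poly_ring {1..n}"
    and "\<mm> \<equiv> irrelevant_ideal {1..n}"
    and "NI \<equiv> nbhd_ideal G"
    and "H \<equiv> nbhd_hypergraph G"
  shows "associated_prime S (quot_module S (NI \<cdot>\<^bsub>S\<^esub> NI)) \<mm> \<longleftrightarrow>
    (\<exists>C \<subseteq> verts G.
      vertex_cover H C \<and>
      (\<forall>i\<in>C. \<exists>e\<in>hedges H. C \<inter> e = {i}) \<and>
      (\<forall>j\<in>verts G - C. \<exists>j\<^sub>1\<in>nbhd G j. \<exists>j\<^sub>2\<in>nbhd G j.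
        closed_nbhd G j\<^sub>1 \<subseteq> verts G - C \<and>
        closed_nbhd G j\<^sub>2 \<subseteq> verts G - C \<and>
        gdist G j\<^sub>1 j\<^sub>2 = 2 \<and>
        gdist (pre_digraph.del_vert G j) j\<^sub>1 j\<^sub>2 \<ge> 3))"
proof -
  interpret graph G by fact
  let ?V = "verts G" and ?N = "closed_nbhd G"
  have N: "?N i \<subseteq> ?V" if "i \<in> ?V" for i
    using closed_nbhd_subset_verts wf_digraph_axioms that .
  have "0 < diam G" using \<open>diam G \<ge> 3\<close> by (rule less_le_trans[rotated]) simp
  then have no_isolated: "?N v \<noteq> {v}" if "v \<in> ?V" for v
    using closed_nbhd_ne_singleton[OF assms(1,3) _ that] by simp
  have "i \<in> ?V \<and> j \<in> ?V \<and> 3 \<le> gdist G i j \<longleftrightarrow>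
      i \<in> ?V \<and> j \<in> ?V \<and> ?N i \<inter> ?N j = {}" for i j
    using three_le_gdist_iff[OF wf_digraph_axioms sym_arcs] by blast
  then have hedges: "hedges H = {?N i \<union> ?N j | i j. i \<in> ?V \<and> j \<in> ?V \<and> ?N i \<inter> ?N j = {}}"
    unfolding H_def nbhd_hypergraph_def by (simp only: snd_conv)
  have edges: "(\<exists>e\<in>hedges H. P e) \<longleftrightarrow>
      (\<exists>i\<in>?V. \<exists>j\<in>?V. ?N i \<inter> ?N j = {} \<and> P (?N i \<union> ?N j))" for P
  proof
    assume "\<exists>e\<in>hedges H. P e"
    then obtain e where e: "e \<in> hedges H" "P e" by blast
    then obtain i j where "e = ?N i \<union> ?N j" "i \<in> ?V" "j \<in> ?V" "?N i \<inter> ?N j = {}"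
      unfolding hedges by blast
    with e(2) show "\<exists>i\<in>?V. \<exists>j\<in>?V. ?N i \<inter> ?N j = {} \<and> P (?N i \<union> ?N j)"
      by (intro bexI[of _ i] bexI[of _ j] conjI) simp_all
  next
    assume "\<exists>i\<in>?V. \<exists>j\<in>?V. ?N i \<inter> ?N j = {} \<and> P (?N i \<union> ?N j)"
    then obtain i j where ij: "i \<in> ?V" "j \<in> ?V" "?N i \<inter> ?N j = {}" and P: "P (?N i \<union> ?N j)"
      by (elim bexE conjE)
    have "?N i \<union> ?N j \<in> hedges H" using ij unfolding hedges
      by (intro CollectI exI[of _ i] exI[of _ j] conjI refl)
    with P show "\<exists>e\<in>hedges H. P e" by (rule bexI)
  qed
  have cover: "vertex_cover H C \<longleftrightarrow>
      (\<forall>i\<in>?V. \<forall>j\<in>?V. ?N i \<inter> ?N j = {} \<longrightarrow> C \<inter> (?N i \<union> ?N j) \<noteq> {})" if "C \<subseteq> ?V" for C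
  proof -
    have "hverts H = ?V" by (simp add: H_def nbhd_hypergraph_def)
    moreover have "(\<forall>e\<in>hedges H. C \<inter> e \<noteq> {}) \<longleftrightarrow> \<not> (\<exists>e\<in>hedges H. C \<inter> e = {})" by simp
    ultimately show ?thesis
      using that unfolding vertex_cover_def by (simp only: edges) simp
  qed
  have nb: "nbhd G k \<subseteq> ?V" for k
    by (auto simp: nbhd_def arcs_ends_iff)
  have outside: "(\<exists>i\<in>?V. \<exists>j\<in>?V. ?N i \<subseteq> ?V - C \<and> ?N j \<subseteq> ?V - C \<and> ?N i \<inter> ?N j = {k}) \<longleftrightarrow>
      (\<exists>i\<in>nbhd G k. \<exists>j\<in>nbhd G k. ?N i \<subseteq> ?V - C \<and> ?N j \<subseteq> ?V - C \<and> gdist G i j = 2 \<and>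
        3 \<le> gdist (pre_digraph.del_vert G k) i j)" if k: "k \<in> ?V" for C k
  proof -
    have "i \<in> ?V \<and> j \<in> ?V \<and> ?N i \<inter> ?N j = {k} \<longleftrightarrow>
        i \<in> nbhd G k \<and> j \<in> nbhd G k \<and> gdist G i j = 2 \<and>
        3 \<le> gdist (pre_digraph.del_vert G k) i j" for i j
      using closed_nbhd_Int_eq_singleton_iff[OF assms(1) _ _ k no_isolated, of i j] nb[of k]
      by (meson subsetD)
    then show ?thesis by meson
  qed
  have "associated_prime S (quot_module S (NI \<cdot>\<^bsub>S\<^esub> NI)) \<mm> \<longleftrightarrow>
      (\<exists>C\<subseteq>?V. (\<forall>i\<in>?V. \<forall>j\<in>?V. ?N i \<inter> ?N j = {} \<longrightarrow> C \<inter> (?N i \<union> ?N j) \<noteq> {}) \<and>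
        (\<forall>k\<in>C. \<exists>i\<in>?V. \<exists>j\<in>?V. ?N i \<inter> ?N j = {} \<and> C \<inter> (?N i \<union> ?N j) = {k}) \<and>
        (\<forall>k\<in>?V - C. \<exists>i\<in>?V. \<exists>j\<in>?V. ?N i \<subseteq> ?V - C \<and> ?N j \<subseteq> ?V - C \<and> ?N i \<inter> ?N j = {k}))"
    unfolding S_def \<mm>_def NI_def nbhd_ideal_def assms(2)[symmetric]
    by (rule associated_prime_square_squarefree_iff[OF finite_verts]) (rule N)
  also have "\<dots> \<longleftrightarrow> (\<exists>C\<subseteq>?V. vertex_cover H C \<and> (\<forall>i\<in>C. \<exists>e\<in>hedges H. C \<inter> e = {i}) \<and>
      (\<forall>k\<in>?V - C. \<exists>i\<in>nbhd G k. \<exists>j\<in>nbhd G k. ?N i \<subseteq> ?V - C \<and> ?N j \<subseteq> ?V - C \<and>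
        gdist G i j = 2 \<and> 3 \<le> gdist (pre_digraph.del_vert G k) i j))"
    by (intro ex_cong1 conj_cong refl ball_cong)
      (simp_all only: cover edges outside Diff_iff)
  finally show ?thesis .
qed

end
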